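(* Let $n\ge 3$ be odd and $t>0$. If $\mathbf{Q}$ and $\mathbf{R}$ are plane $n$-gons with $\mathbf{Q}\stackrel{t}{\sim}\mathbf{R}$, then $\mathcal{A}(\mathbf{Q})=\mathcal{A}(\mathbf{R})$.
   Context: A plane $n$-gon is an $n$-tuple $\mathbf{P}=(P_1,\dots,P_n)$ of points in $\mathbb{R}^2$, indices cyclic mod $n$. For $\mathbf{P}$ with $P_i\neq P_{i+1}$ for all $i$, define $q_t(\mathbf{P})=\mathbf{Q}$ and $r_t(\mathbf{P})=\mathbf{R}$ by $$Q_i=P_i+t\frac{P_i-P_{i-1}}{|P_i-P_{i-1}|},\qquad R_i=P_i+t\frac{P_i-P_{i+1}}{|P_i-P_{i+1}|}.$$ The relation $\mathbf{Q}\stackrel{t}{\sim}\mathbf{R}$ means that $\mathbf{Q}=q_t(\mathbf{P})$, $\mathbf{R}=r_t(\mathbf{P})$ for some such $\mathbf{P}$. The algebraic multi-area of an $n$-gon is $$\mathcal{A}(\mathbf{P})=\sum_{1\le i<j\le n}(-1)^{i+j}\det(P_i,P_j)=\sum_{k=1}^{(n-1)/2}(-1)^k\sum_{i=1}^n\det(P_i,P_{i+k}).$$ *)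

theory Defs
  imports "HOL-Analysis.Analysis"
begin

text \<open>A plane \<open>n\<close>-gon, an \<open>n\<close>-tuple with indices cyclic mod \<open>n\<close>, is encoded as an
  \<open>n\<close>-periodic function on the integers; its vertices are the values at \<open>1, \<dots>, n\<close>.\<close>

definition plane_ngon :: "nat \<Rightarrow> (int \<Rightarrow> real^2) \<Rightarrow> bool" where
  "plane_ngon n P \<longleftrightarrow> (\<forall>i. P (i + int n) = P i)"

definition q_map :: "real \<Rightarrow> (int \<Rightarrow> real^2) \<Rightarrow> (int \<Rightarrow> real^2)" where
  "q_map t P = (\<lambda>i. P i + t *\<^sub>R ((P i - P (i - 1)) /\<^sub>R norm (P i - P (i - 1))))"

definition r_map :: "real \<Rightarrow> (int \<Rightarrow> real^2) \<Rightarrow> (int \<Rightarrow> real^2)" where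
  "r_map t P = (\<lambda>i. P i + t *\<^sub>R ((P i - P (i + 1)) /\<^sub>R norm (P i - P (i + 1))))"

definition t_related :: "nat \<Rightarrow> real \<Rightarrow> (int \<Rightarrow> real^2) \<Rightarrow> (int \<Rightarrow> real^2) \<Rightarrow> bool" where
  "t_related n t Q R \<longleftrightarrow>
     (\<exists>P. plane_ngon n P \<and> (\<forall>i. P i \<noteq> P (i + 1)) \<and> Q = q_map t P \<and> R = r_map t P)"

text \<open>The determinant of a pair of vectors is that of the \<open>2 \<times> 2\<close> matrix with these rows.\<close>

definition multi_area :: "nat \<Rightarrow> (int \<Rightarrow> real^2) \<Rightarrow> real" where
  "multi_area n P =
     (\<Sum>j = 1..n. \<Sum>i = 1..<j. (-1) ^ (i + j) * det (vector [P (int i), P (int j)] :: real^2^2))"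

end

theory Submission imports Defs begin

text \<open>With \<open>u\<^sub>i\<close> the unit vector along \<open>P\<^sub>i\<^sub>+\<^sub>1 - P\<^sub>i\<close> we have
  \<open>Q\<^sub>i = P\<^sub>i + t u\<^sub>i\<^sub>-\<^sub>1\<close> and \<open>R\<^sub>i = P\<^sub>i - t u\<^sub>i\<close>. Polarize the quadratic form
  \<open>\<A>\<close> at the midpoints \<open>(Q\<^sub>i + R\<^sub>i) / 2\<close>: since \<open>Q\<^sub>j - R\<^sub>j = t (u\<^sub>j\<^sub>-\<^sub>1 + u\<^sub>j)\<close>, the
  alternating sums telescope, and for odd \<open>n\<close> the boundary terms cancel, leaving
  \<open>\<A>(Q) - \<A>(R) = t \<Sum> det(P\<^sub>i, u\<^sub>i\<^sub>-\<^sub>1 - u\<^sub>i) = t \<Sum> det(P\<^sub>i\<^sub>+\<^sub>1 - P\<^sub>i, u\<^sub>i) = 0\<close>.\<close>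

definition cross2 :: "real^2 \<Rightarrow> real^2 \<Rightarrow> real" where
  "cross2 a b = a $ 1 * b $ 2 - a $ 2 * b $ 1"

lemma det_vector_eq_cross2: "det (vector [a, b] :: real^2^2) = cross2 a b"
  by (simp add: det_2 cross2_def)

lemma cross2_add_right: "cross2 a (b + c) = cross2 a b + cross2 a c"
  by (simp add: cross2_def algebra_simps)

lemma cross2_diff_right: "cross2 a (b - c) = cross2 a b - cross2 a c"
  by (simp add: cross2_def algebra_simps)

lemma cross2_scaleR_right: "cross2 a (c *\<^sub>R b) = c * cross2 a b"
  by (simp add: cross2_def algebra_simps)

lemma cross2_sum_right: "cross2 a (\<Sum>i\<in>A. f i) = (\<Sum>i\<in>A. cross2 a (f i))"
  by (simp add: cross2_def sum_subtractf sum_distrib_left)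

text \<open>Bilinearity splits the difference into mean-times-difference terms; antisymmetry
  accounts for the minus sign.\<close>

lemma cross2_diff_polarize:
  "cross2 a b - cross2 c d =
     cross2 ((a + c) /\<^sub>R 2) (b - d) - cross2 ((b + d) /\<^sub>R 2) (a - c)"
  by (simp add: cross2_def field_simps)

lemma alternating_sum_telescope:
  fixes w :: "int \<Rightarrow> 'a::real_vector"
  shows "(\<Sum>i = 1..m. (-1::real) ^ i *\<^sub>R (w (int i - 1) + w (int i))) = (-1) ^ m *\<^sub>R w (int m) - w 0"
  by (induction m) (simp_all add: algebra_simps)

lemma multi_area_Suc:
  "multi_area (Suc m) P =
     multi_area m P + (\<Sum>i = 1..m. (-1) ^ (i + Suc m) * cross2 (P (int i)) (P (int (Suc m))))"
  by (simp add: multi_area_def det_vector_eq_cross2 atLeastLessThanSuc_atLeastAtMost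
      del: power_Suc of_nat_Suc)

text \<open>Neither parity nor periodicity is assumed, so induction on \<open>m\<close> goes
  through. The part with \<open>(-1) ^ i\<close> is the boundary contribution; it vanishes for odd
  \<open>m\<close> with \<open>w m = w 0\<close>.\<close>

lemma multi_area_diff:
  fixes Q R w :: "int \<Rightarrow> real^2"
  assumes D: "\<And>j. Q j - R j = w (j - 1) + w j"
  shows "multi_area m Q - multi_area m R =
    (\<Sum>i = 1..m. cross2 ((Q (int i) + R (int i)) /\<^sub>R 2)
       (w (int i - 1) - w (int i) + (-1) ^ i *\<^sub>R (w 0 + (-1) ^ m *\<^sub>R w (int m))))"
proof (induction m)
  case 0
  show ?case by (simp add: multi_area_def)
next
  case (Suc m)
  define S where "S i = (Q i + R i) /\<^sub>R 2" for i
  let ?k = "int (Suc m)"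
  have k: "?k - 1 = int m" by simp
  have "(\<Sum>i = 1..m. (-1) ^ (i + Suc m) * cross2 (Q (int i)) (Q ?k)) -
      (\<Sum>i = 1..m. (-1) ^ (i + Suc m) * cross2 (R (int i)) (R ?k)) =
      (\<Sum>i = 1..m. (-1) ^ (i + Suc m) *
         (cross2 (S (int i)) (Q ?k - R ?k) - cross2 (S ?k) (Q (int i) - R (int i))))"
    unfolding S_def cross2_diff_polarize[symmetric]
    by (simp only: sum_subtractf[symmetric] right_diff_distrib[symmetric])
  also have "\<dots> = (\<Sum>i = 1..m. (-1) ^ (i + Suc m) * cross2 (S (int i)) (w (int m) + w ?k)) -
      (-1) ^ Suc m * cross2 (S ?k) (\<Sum>i = 1..m. (-1) ^ i *\<^sub>R (w (int i - 1) + w (int i)))"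
    unfolding D k
    by (simp add: cross2_sum_right cross2_scaleR_right sum_subtractf sum_distrib_left
        right_diff_distrib power_add mult_ac sum_negf)
  also have "(-1) ^ Suc m * cross2 (S ?k) (\<Sum>i = 1..m. (-1) ^ i *\<^sub>R (w (int i - 1) + w (int i))) =
      - cross2 (S ?k) (w (int m) + (-1) ^ Suc m *\<^sub>R w 0)"
    unfolding alternating_sum_telescope
    by (simp add: cross2_diff_right cross2_add_right cross2_scaleR_right algebra_simps
        flip: power_add mult.assoc)
  finally have step: "(multi_area (Suc m) Q - multi_area (Suc m) R) - (multi_area m Q - multi_area m R) =
      (\<Sum>i = 1..m. (-1) ^ (i + Suc m) * cross2 (S (int i)) (w (int m) + w ?k)) +
      cross2 (S ?k) (w (int m) + (-1) ^ Suc m *\<^sub>R w 0)"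
    unfolding multi_area_Suc by linarith
  \<comment> \<open>Going from \<open>m\<close> to \<open>Suc m\<close> changes the boundary vector
    by \<open>(-1) ^ Suc m *\<^sub>R (w (int m) + w ?k)\<close>.\<close>
  have "(\<Sum>i = 1..m. cross2 (S (int i))
        (w (int i - 1) - w (int i) + (-1) ^ i *\<^sub>R (w 0 + (-1) ^ Suc m *\<^sub>R w ?k))) =
      (\<Sum>i = 1..m. cross2 (S (int i))
        (w (int i - 1) - w (int i) + (-1) ^ i *\<^sub>R (w 0 + (-1) ^ m *\<^sub>R w (int m)))) +
      (\<Sum>i = 1..m. (-1) ^ (i + Suc m) * cross2 (S (int i)) (w (int m) + w ?k))"
    unfolding sum.distrib[symmetric]
    by (rule sum.cong) (simp_all add: cross2_add_right cross2_diff_right cross2_scaleR_right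
        power_add algebra_simps del: of_nat_Suc)
  \<comment> \<open>In the new summand the two signs before \<open>w ?k\<close> multiply to 1,
    cancelling \<open>- w ?k\<close>.\<close>
  moreover have "cross2 (S ?k)
        (w (?k - 1) - w ?k + (-1) ^ Suc m *\<^sub>R (w 0 + (-1) ^ Suc m *\<^sub>R w ?k)) =
      cross2 (S ?k) (w (int m) + (-1) ^ Suc m *\<^sub>R w 0)"
    unfolding k by (simp add: scaleR_diff_right flip: power_add)
  ultimately have "(\<Sum>i = 1..Suc m. cross2 (S (int i))
        (w (int i - 1) - w (int i) + (-1) ^ i *\<^sub>R (w 0 + (-1) ^ Suc m *\<^sub>R w ?k))) =
      multi_area (Suc m) Q - multi_area (Suc m) R"
    using step Suc.IH[folded S_def]
    by (simp only: sum.cl_ivl_Suc) simp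
  then show ?case by (simp only: S_def)
qed

theorem lemma3p4:
  fixes n :: nat and t :: real and Q R :: "int \<Rightarrow> real^2"
  assumes "n \<ge> 3" and "odd n" and "t > 0"
    and "plane_ngon n Q" and "plane_ngon n R"
    and "t_related n t Q R"
  shows "multi_area n Q = multi_area n R"
proof -
  obtain P where P: "plane_ngon n P" and Q: "Q = q_map t P" and R: "R = r_map t P"
    using assms(6) unfolding t_related_def by blast
  define w where "w i = t *\<^sub>R ((P (i + 1) - P i) /\<^sub>R norm (P (i + 1) - P i))" for i
  have Qi: "Q i = P i + w (i - 1)" for i
    by (simp add: Q q_map_def w_def)
  have Ri: "R i = P i - w i" for i
    by (simp add: R r_map_def w_def norm_minus_commute algebra_simps)
  have per: "P (int n + i) = P i" for i
    using P by (simp add: plane_ngon_def add.commute)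
  have wn: "w (int n) = w 0"
    using per[of 0] per[of 1] by (simp add: w_def)
  have parallel: "cross2 (P (i + 1)) (w i) = cross2 (P i) (w i)" for i
    by (simp add: w_def cross2_def algebra_simps)
  have "multi_area n Q - multi_area n R =
      (\<Sum>i = 1..n. cross2 ((Q (int i) + R (int i)) /\<^sub>R 2)
        (w (int i - 1) - w (int i) + (-1) ^ i *\<^sub>R (w 0 + (-1) ^ n *\<^sub>R w (int n))))"
    by (rule multi_area_diff) (simp add: Qi Ri)
  \<comment> \<open>The midpoint is \<open>P i + (w (i - 1) - w i) /\<^sub>R 2\<close>, and its
    second part is parallel to the other argument.\<close>
  also have "\<dots> = (\<Sum>i = 1..n. cross2 (P (int i)) (w (int i - 1)) - cross2 (P (int i)) (w (int i)))"
    using \<open>odd n\<close> by (intro sum.cong) (simp_all add: wn Qi Ri cross2_def field_simps)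
  \<comment> \<open>Sliding along edge i - 1 makes both terms values of
    \<open>cross2 (P j) (w j)\<close> at consecutive j, so the sum telescopes.\<close>
  also have "\<dots> = (\<Sum>i = 1..n. cross2 (P (int i - 1)) (w (int i - 1)) - cross2 (P (int i)) (w (int i)))"
    using parallel[of "int i - 1" for i] by simp
  also have "\<dots> = cross2 (P 0) (w 0) - cross2 (P (int n)) (w (int n))"
    by (induction n) simp_all
  also have "\<dots> = 0"
    using wn per[of 0] by simp
  finally show ?thesis by simp
qed

end
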